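(* Let $(\mathfrak g,\cdot_{\mathfrak g})$ be a pre-Lie algebra and $r_1,r_2$ two compatible $\mathfrak s$-matrices. Suppose that $r_2$ is invertible. Then $N=r_1^\sharp\circ(r_2^\sharp)^{-1}:\mathfrak g\to\mathfrak g$ is a Nijenhuis operator on $(\mathfrak g,\cdot_{\mathfrak g})$. Furthermore, if $r_1$ is also invertible, then $(\mathfrak g,\cdot_{\mathfrak g},\mathfrak B,N)$ is a pseudo-Hessian-Nijenhuis pre-Lie algebra, where $\mathfrak B(x,y)=\langle x,(r_1^\sharp)^{-1}(y)\rangle$ for all $x,y\in\mathfrak g$.
   Context: $\mathbb K$ is an algebraically closed field of characteristic $0$; vector spaces are finite dimensional over $\mathbb K$. A pre-Lie algebra is a vector space $\mathfrak g$ with a bilinear product $\cdot_{\mathfrak g}$ such that $(x\cdot_{\mathfrak g} y)\cdot_{\mathfrak g} z-x\cdot_{\mathfrak g}(y\cdot_{\mathfrak g} z)$ is symmetric in $x,y$; $[x,y]^c=x\cdot_{\mathfrak g}y-y\cdot_{\mathfrak g}x$. For $r\in\mathrm{Sym}^2(\mathfrak g)$, $r^\sharp:\mathfrak g^*\to\mathfrak g$ is given by $\langle r^\sharp(\xi),\eta\rangle=r(\xi,\eta)$; $r$ is invertible if $r^\sharp$ is an isomorphism. For $r_1,r_2\in\mathrm{Sym}^2(\mathfrak g)$ and $\xi,\eta,\zeta\in\mathfrak g^*$ put \begin{align*}\llbracket r_1,r_2\rrbracket(\xi,\eta,\zeta)=\tfrac12\big(&-\langle\xi,r_1^\sharp(\eta)\cdot_{\mathfrak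 g}r_2^\sharp(\zeta)+r_2^\sharp(\eta)\cdot_{\mathfrak g}r_1^\sharp(\zeta)\rangle+\langle\eta,r_1^\sharp(\xi)\cdot_{\mathfrak g}r_2^\sharp(\zeta)+r_2^\sharp(\xi)\cdot_{\mathfrak g}r_1^\sharp(\zeta)\rangle\\&+\langle\zeta,[r_1^\sharp(\xi),r_2^\sharp(\eta)]^c+[r_2^\sharp(\xi),r_1^\sharp(\eta)]^c\rangle\big).\end{align*} An $\mathfrak s$-matrix is $r\in\mathrm{Sym}^2(\mathfrak g)$ with $\llbracket r,r\rrbracket=0$. Two $\mathfrak s$-matrices $r_1,r_2$ are compatible if $\llbracket r_1,r_2\rrbracket=0$. A linear map $N:\mathfrak g\to\mathfrak g$ is a Nijenhuis operator if $N(x)\cdot_{\mathfrak g}N(y)=N\big(N(x)\cdot_{\mathfrak g}y+x\cdot_{\mathfrak g}N(y)-N(x\cdot_{\mathfrak g}y)\big)$ for all $x,y$. A symmetric bilinear form $\mathfrak B$ on $\mathfrak g$ is closed if $\mathfrak B(x\cdot_{\mathfrak g}y,z)-\mathfrak B(x,y\cdot_{\mathfrak g}z)=\mathfrak B(y\cdot_{\mathfrak g}x,z)-\mathfrak B(y,x\cdot_{\mathfrak g}z)$ for all $x,y,z$; a pseudo-Hessian structure is a nondegenerate closed symmetric bilinear form. $(\mathfrak g,\cdot_{\mathfrak g},\mathfrak B,N)$ is a pseudo-Hessian-Nijenhuis pre-Lie algebra if $\mathfrak B$ is a pseudo-Hessian structure, $N$ is an invertible Nijenhuis operator, $\mathfrak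 B(N(x),y)=\mathfrak B(x,N(y))$ for all $x,y$, and $\mathfrak B_1(x,y)=\mathfrak B(x,N(y))$ is closed. *)

theory Defs
  imports Complex_Main "HOL-Computational_Algebra.Polynomial"
begin

text \<open>
  A vector space over the field \<^typ>\<open>'k\<close> is a type \<^typ>\<open>'g\<close> with a scalar multiplication
  \<open>scale\<close> satisfying the library locale \<^locale>\<open>vector_space\<close>.
\<close>

locale pre_lie_algebra = vector_space scale
  for scale :: "'k::field \<Rightarrow> 'g::ab_group_add \<Rightarrow> 'g" +
  fixes mul :: "'g \<Rightarrow> 'g \<Rightarrow> 'g"  (infixl "\<cdot>" 70)
  assumes mul_linear_right: "Vector_Spaces.linear scale scale (\<lambda>y. x \<cdot> y)"
    and mul_linear_left: "Vector_Spaces.linear scale scale (\<lambda>x. x \<cdot> y)"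
    and associator_sym: "(x \<cdot> y) \<cdot> z - x \<cdot> (y \<cdot> z) = (y \<cdot> x) \<cdot> z - y \<cdot> (x \<cdot> z)"

definition commutator :: "('g \<Rightarrow> 'g \<Rightarrow> 'g) \<Rightarrow> 'g \<Rightarrow> 'g \<Rightarrow> 'g::ab_group_add" where
  "commutator mul x y = mul x y - mul y x"

subsection \<open>The dual space and symmetric 2-tensors\<close>

text \<open>
  The dual space is a set of functions with pointwise operations; the pairing
  \<open>\<langle>\<xi>, x\<rangle>\<close> is the application \<open>\<xi> x\<close>.
\<close>

definition dual :: "('k::field \<Rightarrow> 'g::ab_group_add \<Rightarrow> 'g) \<Rightarrow> ('g \<Rightarrow> 'k) set" where
  "dual scale = {\<xi>. Vector_Spaces.linear scale (*) \<xi>}"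

text \<open>Linearity of a map from the dual space to a vector space with scalar multiplication \<open>scaleW\<close>.\<close>

definition linear_on_dual ::
  "('k::field \<Rightarrow> 'g::ab_group_add \<Rightarrow> 'g) \<Rightarrow> ('k \<Rightarrow> 'w::ab_group_add \<Rightarrow> 'w) \<Rightarrow> (('g \<Rightarrow> 'k) \<Rightarrow> 'w) \<Rightarrow> bool" where
  "linear_on_dual scale scaleW f \<longleftrightarrow>
     (\<forall>\<xi>\<in>dual scale. \<forall>\<eta>\<in>dual scale. f (\<lambda>x. \<xi> x + \<eta> x) = f \<xi> + f \<eta>) \<and>
     (\<forall>c. \<forall>\<xi>\<in>dual scale. f (\<lambda>x. c * \<xi> x) = scaleW c (f \<xi>))"

text \<open>
  As the space is finite dimensional, an element \<open>r\<close> of \<open>Sym\<^sup>2(\<gg>)\<close> is the same as the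
  symmetric bilinear form \<open>(\<xi>, \<eta>) \<mapsto> r(\<xi>, \<eta>)\<close> on the dual space, a simple tensor
  \<open>x \<otimes> y\<close> being the form \<open>\<xi> x * \<eta> y\<close>. Values outside the dual space are irrelevant.
\<close>

definition Sym2 ::
  "('k::field \<Rightarrow> 'g::ab_group_add \<Rightarrow> 'g) \<Rightarrow> (('g \<Rightarrow> 'k) \<Rightarrow> ('g \<Rightarrow> 'k) \<Rightarrow> 'k) set" where
  "Sym2 scale = {r.
     (\<forall>\<xi>\<in>dual scale. linear_on_dual scale (*) (\<lambda>\<eta>. r \<xi> \<eta>)) \<and>
     (\<forall>\<eta>\<in>dual scale. linear_on_dual scale (*) (\<lambda>\<xi>. r \<xi> \<eta>)) \<and>
     (\<forall>\<xi>\<in>dual scale. \<forall>\<eta>\<in>dual scale. r \<xi> \<eta> = r \<eta> \<xi>)}"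

text \<open>
  The vector \<open>r\<^sup>\<sharp>(\<xi>)\<close> is characterised by \<open>\<langle>r\<^sup>\<sharp>(\<xi>), \<eta>\<rangle> = r(\<xi>, \<eta>)\<close>; existence and
  uniqueness in finite dimension are lemma \<open>sharp_exists_unique\<close> below.
\<close>

definition sharp ::
  "('k::field \<Rightarrow> 'g::ab_group_add \<Rightarrow> 'g) \<Rightarrow> (('g \<Rightarrow> 'k) \<Rightarrow> ('g \<Rightarrow> 'k) \<Rightarrow> 'k) \<Rightarrow> ('g \<Rightarrow> 'k) \<Rightarrow> 'g" where
  "sharp scale r \<xi> = (THE x. \<forall>\<eta>\<in>dual scale. \<eta> x = r \<xi> \<eta>)"

definition tensor_invertible ::
  "('k::field \<Rightarrow> 'g::ab_group_add \<Rightarrow> 'g) \<Rightarrow> (('g \<Rightarrow> 'k) \<Rightarrow> ('g \<Rightarrow> 'k) \<Rightarrow> 'k) \<Rightarrow> bool" where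
  "tensor_invertible scale r \<longleftrightarrow>
     linear_on_dual scale scale (sharp scale r) \<and> bij_betw (sharp scale r) (dual scale) UNIV"

definition sharp_inv ::
  "('k::field \<Rightarrow> 'g::ab_group_add \<Rightarrow> 'g) \<Rightarrow> (('g \<Rightarrow> 'k) \<Rightarrow> ('g \<Rightarrow> 'k) \<Rightarrow> 'k) \<Rightarrow> 'g \<Rightarrow> ('g \<Rightarrow> 'k)" where
  "sharp_inv scale r = inv_into (dual scale) (sharp scale r)"

lemma (in finite_dimensional_vector_space) sharp_exists_unique:
  assumes r: "r \<in> Sym2 scale" and xi: "\<xi> \<in> dual scale"
  shows "\<exists>!x. \<forall>\<eta>\<in>dual scale. \<eta> x = r \<xi> \<eta>"
proof -
  have vsK: "vector_space ((*) :: 'a \<Rightarrow> 'a \<Rightarrow> 'a)"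
    by unfold_locales (auto simp: algebra_simps)
  define d where "d b = (\<lambda>v. representation Basis v b)" for b
  have d_dual: "d b \<in> dual scale" for b
    unfolding dual_def d_def mem_Collect_eq Vector_Spaces.linear_def module_hom_def
      module_hom_axioms_def module_iff_vector_space
    using independent_Basis span_Basis vsK vector_space_axioms
    by (auto simp: representation_add representation_scale)
  have repr: "(\<Sum>b\<in>Basis. scale (d b v) b) = v" for v
    unfolding d_def using independent_Basis finite_Basis span_Basis
    by (intro sum_representation_eq) auto
  have lin_r: "linear_on_dual scale (*) (r \<xi>)"
    using r xi by (auto simp: Sym2_def)
  have r_add: "r \<xi> (\<lambda>v. \<alpha> v + \<beta> v) = r \<xi> \<alpha> + r \<xi> \<beta>" and r_scale: "r \<xi> (\<lambda>v. c * \<alpha> v) = c * r \<xi> \<alpha>"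
    if "\<alpha> \<in> dual scale" "\<beta> \<in> dual scale" for \<alpha> \<beta> c
    using lin_r that unfolding linear_on_dual_def by simp_all
  have zero_dual: "(\<lambda>v. 0) \<in> dual scale"
    unfolding dual_def mem_Collect_eq Vector_Spaces.linear_def module_hom_def
      module_hom_axioms_def module_iff_vector_space
    using vsK vector_space_axioms by auto
  have add_dual: "(\<lambda>v. \<alpha> v + \<beta> v) \<in> dual scale" and scale_dual: "(\<lambda>v. c * \<alpha> v) \<in> dual scale"
    if "\<alpha> \<in> dual scale" "\<beta> \<in> dual scale" for \<alpha> \<beta> c
    using that unfolding dual_def mem_Collect_eq Vector_Spaces.linear_def module_hom_def
      module_hom_axioms_def by (auto simp: algebra_simps)
  have r_zero: "r \<xi> (\<lambda>v. 0) = 0"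
    using r_scale[OF zero_dual zero_dual, of 0] by simp
  have r_sum: "(\<lambda>v. \<Sum>b\<in>A. c b * d b v) \<in> dual scale \<and>
      r \<xi> (\<lambda>v. \<Sum>b\<in>A. c b * d b v) = (\<Sum>b\<in>A. c b * r \<xi> (d b))" if "finite A" for A c
    using that
  proof (induction A)
    case empty
    then show ?case using zero_dual r_zero by simp
  next
    case (insert a A)
    let ?s = "\<lambda>v. \<Sum>b\<in>A. c b * d b v"
    have 1: "(\<lambda>v. c a * d a v) \<in> dual scale" by (rule scale_dual) (rule d_dual)+
    have "r \<xi> (\<lambda>v. c a * d a v + ?s v) = r \<xi> (\<lambda>v. c a * d a v) + r \<xi> ?s"
      using 1 insert.IH by (intro r_add) auto
    moreover have "r \<xi> (\<lambda>v. c a * d a v) = c a * r \<xi> (d a)"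
      by (rule r_scale) (rule d_dual)+
    moreover have "(\<lambda>v. c a * d a v + ?s v) \<in> dual scale"
      using 1 insert.IH by (intro add_dual) auto
    ultimately show ?case using insert by simp
  qed
  have expand: "\<eta> (\<Sum>b\<in>Basis. scale (c b) b) = (\<Sum>b\<in>Basis. c b * \<eta> b)"
    if "\<eta> \<in> dual scale" for \<eta> c
  proof -
    interpret h: Vector_Spaces.linear scale "(*)" \<eta> using that by (simp add: dual_def)
    show ?thesis by (simp add: h.sum h.scale)
  qed
  show ?thesis
  proof (rule ex1I)
    show "\<forall>\<eta>\<in>dual scale. \<eta> (\<Sum>b\<in>Basis. scale (r \<xi> (d b)) b) = r \<xi> \<eta>"
    proof
      fix \<eta> assume eta: "\<eta> \<in> dual scale"
      have "\<eta> = (\<lambda>v. \<Sum>b\<in>Basis. \<eta> b * d b v)"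
      proof
        fix v
        show "\<eta> v = (\<Sum>b\<in>Basis. \<eta> b * d b v)"
          using expand[OF eta, of "\<lambda>b. d b v"] by (simp add: repr mult.commute)
      qed
      then have "r \<xi> \<eta> = (\<Sum>b\<in>Basis. \<eta> b * r \<xi> (d b))"
        using r_sum[OF finite_Basis, of \<eta>] by simp
      then show "\<eta> (\<Sum>b\<in>Basis. scale (r \<xi> (d b)) b) = r \<xi> \<eta>"
        using expand[OF eta] by (simp add: mult.commute)
    qed
  next
    fix x assume x: "\<forall>\<eta>\<in>dual scale. \<eta> x = r \<xi> \<eta>"
    have "(\<Sum>b\<in>Basis. scale (d b x) b) = (\<Sum>b\<in>Basis. scale (r \<xi> (d b)) b)"
      using x d_dual by simp
    then show "x = (\<Sum>b\<in>Basis. scale (r \<xi> (d b)) b)" by (simp add: repr)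
  qed
qed

subsection \<open>\<open>\<ss>\<close>-matrices\<close>

definition s_bracket ::
  "('k::field \<Rightarrow> 'g::ab_group_add \<Rightarrow> 'g) \<Rightarrow> ('g \<Rightarrow> 'g \<Rightarrow> 'g) \<Rightarrow>
   (('g \<Rightarrow> 'k) \<Rightarrow> ('g \<Rightarrow> 'k) \<Rightarrow> 'k) \<Rightarrow> (('g \<Rightarrow> 'k) \<Rightarrow> ('g \<Rightarrow> 'k) \<Rightarrow> 'k) \<Rightarrow>
   ('g \<Rightarrow> 'k) \<Rightarrow> ('g \<Rightarrow> 'k) \<Rightarrow> ('g \<Rightarrow> 'k) \<Rightarrow> 'k" where
  "s_bracket scale mul r1 r2 \<xi> \<eta> \<zeta> =
    (let s1 = sharp scale r1; s2 = sharp scale r2 in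
     (1/2) * (- \<xi> (mul (s1 \<eta>) (s2 \<zeta>) + mul (s2 \<eta>) (s1 \<zeta>))
              + \<eta> (mul (s1 \<xi>) (s2 \<zeta>) + mul (s2 \<xi>) (s1 \<zeta>))
              + \<zeta> (commutator mul (s1 \<xi>) (s2 \<eta>) + commutator mul (s2 \<xi>) (s1 \<eta>))))"

definition s_bracket_vanishes ::
  "('k::field \<Rightarrow> 'g::ab_group_add \<Rightarrow> 'g) \<Rightarrow> ('g \<Rightarrow> 'g \<Rightarrow> 'g) \<Rightarrow>
   (('g \<Rightarrow> 'k) \<Rightarrow> ('g \<Rightarrow> 'k) \<Rightarrow> 'k) \<Rightarrow> (('g \<Rightarrow> 'k) \<Rightarrow> ('g \<Rightarrow> 'k) \<Rightarrow> 'k) \<Rightarrow> bool" where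
  "s_bracket_vanishes scale mul r1 r2 \<longleftrightarrow>
     (\<forall>\<xi>\<in>dual scale. \<forall>\<eta>\<in>dual scale. \<forall>\<zeta>\<in>dual scale. s_bracket scale mul r1 r2 \<xi> \<eta> \<zeta> = 0)"

definition s_matrix ::
  "('k::field \<Rightarrow> 'g::ab_group_add \<Rightarrow> 'g) \<Rightarrow> ('g \<Rightarrow> 'g \<Rightarrow> 'g) \<Rightarrow>
   (('g \<Rightarrow> 'k) \<Rightarrow> ('g \<Rightarrow> 'k) \<Rightarrow> 'k) \<Rightarrow> bool" where
  "s_matrix scale mul r \<longleftrightarrow> r \<in> Sym2 scale \<and> s_bracket_vanishes scale mul r r"

definition compatible_s_matrices ::
  "('k::field \<Rightarrow> 'g::ab_group_add \<Rightarrow> 'g) \<Rightarrow> ('g \<Rightarrow> 'g \<Rightarrow> 'g) \<Rightarrow>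
   (('g \<Rightarrow> 'k) \<Rightarrow> ('g \<Rightarrow> 'k) \<Rightarrow> 'k) \<Rightarrow> (('g \<Rightarrow> 'k) \<Rightarrow> ('g \<Rightarrow> 'k) \<Rightarrow> 'k) \<Rightarrow> bool" where
  "compatible_s_matrices scale mul r1 r2 \<longleftrightarrow>
     s_matrix scale mul r1 \<and> s_matrix scale mul r2 \<and> s_bracket_vanishes scale mul r1 r2"

subsection \<open>Nijenhuis operators and pseudo-Hessian structures\<close>

definition nijenhuis_operator ::
  "('k::field \<Rightarrow> 'g::ab_group_add \<Rightarrow> 'g) \<Rightarrow> ('g \<Rightarrow> 'g \<Rightarrow> 'g) \<Rightarrow> ('g \<Rightarrow> 'g) \<Rightarrow> bool" where
  "nijenhuis_operator scale mul N \<longleftrightarrow>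
     Vector_Spaces.linear scale scale N \<and>
     (\<forall>x y. mul (N x) (N y) = N (mul (N x) y + mul x (N y) - N (mul x y)))"

definition symmetric_bilinear_form ::
  "('k::field \<Rightarrow> 'g::ab_group_add \<Rightarrow> 'g) \<Rightarrow> ('g \<Rightarrow> 'g \<Rightarrow> 'k) \<Rightarrow> bool" where
  "symmetric_bilinear_form scale B \<longleftrightarrow>
     (\<forall>x. Vector_Spaces.linear scale (*) (\<lambda>y. B x y)) \<and>
     (\<forall>y. Vector_Spaces.linear scale (*) (\<lambda>x. B x y)) \<and>
     (\<forall>x y. B x y = B y x)"

definition closed_form ::
  "('k::field \<Rightarrow> 'g::ab_group_add \<Rightarrow> 'g) \<Rightarrow> ('g \<Rightarrow> 'g \<Rightarrow> 'g) \<Rightarrow> ('g \<Rightarrow> 'g \<Rightarrow> 'k) \<Rightarrow> bool" where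
  "closed_form scale mul B \<longleftrightarrow>
     symmetric_bilinear_form scale B \<and>
     (\<forall>x y z. B (mul x y) z - B x (mul y z) = B (mul y x) z - B y (mul x z))"

definition pseudo_hessian_structure ::
  "('k::field \<Rightarrow> 'g::ab_group_add \<Rightarrow> 'g) \<Rightarrow> ('g \<Rightarrow> 'g \<Rightarrow> 'g) \<Rightarrow> ('g \<Rightarrow> 'g \<Rightarrow> 'k) \<Rightarrow> bool" where
  "pseudo_hessian_structure scale mul B \<longleftrightarrow>
     closed_form scale mul B \<and> (\<forall>x. (\<forall>y. B x y = 0) \<longrightarrow> x = 0)"

definition pseudo_hessian_nijenhuis ::
  "('k::field \<Rightarrow> 'g::ab_group_add \<Rightarrow> 'g) \<Rightarrow> ('g \<Rightarrow> 'g \<Rightarrow> 'g) \<Rightarrow> ('g \<Rightarrow> 'g \<Rightarrow> 'k) \<Rightarrow> ('g \<Rightarrow> 'g) \<Rightarrow> bool" where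
  "pseudo_hessian_nijenhuis scale mul B N \<longleftrightarrow>
     pre_lie_algebra scale mul \<and>
     pseudo_hessian_structure scale mul B \<and>
     nijenhuis_operator scale mul N \<and> bij N \<and>
     (\<forall>x y. B (N x) y = B x (N y)) \<and>
     closed_form scale mul (\<lambda>x y. B x (N y))"

end

theory Submission
  imports Defs
begin

text \<open>
  Write \<open>B\<^sub>i(x, y) = \<langle>x, (r\<^sub>i\<^sup>\<sharp>)\<^sup>-\<^sup>1(y)\<rangle>\<close> for the symmetric form inverse to an invertible
  tensor \<open>r\<^sub>i\<close>. Substituting \<open>\<xi> = (r\<^sup>\<sharp>)\<^sup>-\<^sup>1(x)\<close> and so on turns \<open>\<lbrakk>r, r\<rbrakk> = 0\<close> into closedness of
  the inverse form of \<open>r\<close>. This is why \<open>B\<^sub>2\<close>, and \<open>B\<^sub>1\<close> if it exists, are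
  pseudo-Hessian.

  For the Nijenhuis property put \<open>B = B\<^sub>2\<close>, so that \<open>r\<^sub>1\<^sup>\<sharp> = N \<circ> r\<^sub>2\<^sup>\<sharp>\<close> and \<open>N\<close> is self-adjoint for
  \<open>B\<close> by the symmetry of \<open>r\<^sub>1\<close>. Let \<open>f(x, y, z) = B(x, y \<cdot> z)\<close> and
  let \<open>X\<close>, \<open>Y\<close>, \<open>Z\<close> stand for the insertion of \<open>N\<close> in front of the variables \<open>x\<close>, \<open>y\<close>, \<open>z\<close>; these
  commute. The three vanishing brackets amount to
  \<open>v\<^sub>x f(x, y, z) - v\<^sub>y f(y, x, z) - v\<^sub>z (f(z, x, y) - f(z, y, x)) = 0\<close> with
  \<open>v\<^sub>x = (1, X, Y Z)\<close>, \<open>v\<^sub>y = (1, Y, X Z)\<close>, \<open>v\<^sub>z = (1, Z, X Y)\<close>. The entries belong to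
  \<open>\<lbrakk>r\<^sub>2, r\<^sub>2\<rbrakk>\<close>, to \<open>\<lbrakk>r\<^sub>1, r\<^sub>2\<rbrakk>\<close> corrected by multiples of \<open>\<lbrakk>r\<^sub>2, r\<^sub>2\<rbrakk>\<close>, and to \<open>\<lbrakk>r\<^sub>1, r\<^sub>1\<rbrakk>\<close>.
  The row \<open>(-X Y - X Z, X, 1)\<close> annihilates \<open>v\<^sub>y\<close> and \<open>v\<^sub>z\<close> and sends \<open>v\<^sub>x\<close> to \<open>(X - Y) (X - Z)\<close>.
  Hence \<open>(X - Y) (X - Z) f = 0\<close>, and this is the torsion of \<open>N\<close> paired with \<open>x\<close> under \<open>B\<close>.
  Nondegeneracy finishes the argument.

  The second part is then formal: \<open>B\<^sub>1(x, N y) = B\<^sub>2(x, y)\<close>, so that \<open>N\<close> is self-adjoint for \<open>B\<^sub>1\<close>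
  because \<open>B\<^sub>1\<close> and \<open>B\<^sub>2\<close> are symmetric, and the form \<open>B\<^sub>1(x, N y)\<close> is closed because \<open>B\<^sub>2\<close> is.
\<close>

section \<open>Operators compatible with a pseudo-Hessian form\<close>

text \<open>
  Each of the three vanishing brackets supplies one hypothesis: closedness of \<open>B\<close>,
  closedness of \<open>B(x, N y)\<close>, and the bracket of the first tensor as the last hypothesis. The
  proof takes their combination with coefficients \<open>(-X Y - X Z, X, 1)\<close>.
\<close>

lemma nijenhuis_if_closed_forms:
  fixes scale :: "'k::field \<Rightarrow> 'g::ab_group_add \<Rightarrow> 'g"
  assumes B: "pseudo_hessian_structure scale mul B"
    and N: "Vector_Spaces.linear scale scale N"
    and BN: "closed_form scale mul (\<lambda>x y. B x (N y))"
    and NN: "\<And>x y z. B x (mul (N y) (N z)) - B y (mul (N x) (N z))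
                       = B z (commutator mul (N x) (N y))"
  shows "nijenhuis_operator scale mul N"
  unfolding nijenhuis_operator_def
proof (intro conjI allI N)
  have bil: "Vector_Spaces.linear scale (*) (\<lambda>y. B x y)" and sym: "B x y = B y x"
    and nondeg: "(\<And>y. B x y = 0) \<Longrightarrow> x = 0"
    and closed: "B (mul x y) z - B x (mul y z) = B (mul y x) z - B y (mul x z)" for x y z
    using B unfolding pseudo_hessian_structure_def closed_form_def symmetric_bilinear_form_def
    by blast+
  have Nclosed: "B (mul x y) (N z) - B x (N (mul y z)) = B (mul y x) (N z) - B y (N (mul x z))"
    and Nsym: "B x (N y) = B y (N x)" for x y z
    using BN unfolding closed_form_def symmetric_bilinear_form_def by blast+
  have add: "B x (u + v) = B x u + B x v" and diff: "B x (u - v) = B x u - B x v" for x u v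
  proof -
    interpret Vector_Spaces.linear scale "(*)" "B x" by (rule bil)
    show "B x (u + v) = B x u + B x v" "B x (u - v) = B x u - B x v"
      by (rule add diff)+
  qed
  have adj: "B (N x) y = B x (N y)" for x y
    using Nsym sym by metis
  fix y z
  have "B (mul (N y) (N z) - N (mul (N y) z + mul y (N z) - N (mul y z))) x = 0" for x
  proof -
    \<comment> \<open>The coefficient \<open>X\<close> replaces \<open>x\<close> by \<open>N x\<close>, and \<open>X Y\<close> replaces also \<open>y\<close> by \<open>N y\<close>. The
      resulting combination is \<open>(X - Y) (X - Z) f = 0\<close>.\<close>
    have "B x (mul (N y) (N z)) - B (N x) (mul (N y) z) - B (N x) (mul y (N z))
            + B (N x) (N (mul y z)) = 0"
      using closed[of "N x" "N y" z] closed[of "N x" y "N z"] Nclosed[of "N x" y z] NN[of x y z]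
        sym[of "mul (N x) (N y)" z] sym[of "mul (N y) (N x)" z] adj[of y "mul (N x) z"]
      unfolding commutator_def diff by algebra
    then show ?thesis
      by (subst sym) (simp only: add diff adj[symmetric], simp add: algebra_simps)
  qed
  then have "mul (N y) (N z) - N (mul (N y) z + mul y (N z) - N (mul y z)) = 0"
    by (rule nondeg)
  then show "mul (N y) (N z) = N (mul (N y) z + mul y (N z) - N (mul y z))"
    by simp
qed

section \<open>The form inverse to an invertible tensor\<close>

context finite_dimensional_vector_space
begin

lemma dualI:
  assumes "\<And>x y. \<xi> (x + y) = \<xi> x + \<xi> y" "\<And>c x. \<xi> (scale c x) = c * \<xi> x"
  shows "\<xi> \<in> dual scale"
proof -
  have "vector_space ((*) :: 'a \<Rightarrow> 'a \<Rightarrow> 'a)"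
    by unfold_locales (auto simp: algebra_simps)
  then show ?thesis
    unfolding dual_def mem_Collect_eq Vector_Spaces.linear_def module_hom_def
      module_hom_axioms_def module_iff_vector_space
    using assms vector_space_axioms by auto
qed

lemma dual_apply_add: "\<xi> \<in> dual scale \<Longrightarrow> \<xi> (x + y) = \<xi> x + \<xi> y"
  and dual_apply_scale: "\<xi> \<in> dual scale \<Longrightarrow> \<xi> (scale c x) = c * \<xi> x"
  unfolding dual_def mem_Collect_eq Vector_Spaces.linear_def module_hom_def
    module_hom_axioms_def by auto

lemma dual_apply_diff: "\<xi> \<in> dual scale \<Longrightarrow> \<xi> (x - y) = \<xi> x - \<xi> y"
  using dual_apply_add[of \<xi> "x - y" y] by (simp add: algebra_simps)

lemma dual_add: "\<xi> \<in> dual scale \<Longrightarrow> \<eta> \<in> dual scale \<Longrightarrow> (\<lambda>x. \<xi> x + \<eta> x) \<in> dual scale"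
  by (rule dualI) (simp_all add: dual_apply_add dual_apply_scale algebra_simps)

lemma dual_scale: "\<xi> \<in> dual scale \<Longrightarrow> (\<lambda>x. c * \<xi> x) \<in> dual scale"
  by (rule dualI) (simp_all add: dual_apply_add dual_apply_scale algebra_simps)

lemma sharp_pairing:
  assumes "r \<in> Sym2 scale" "\<xi> \<in> dual scale" "\<eta> \<in> dual scale"
  shows "\<eta> (sharp scale r \<xi>) = r \<xi> \<eta>"
  using theI'[OF sharp_exists_unique[OF assms(1,2)]] assms(3)
  unfolding sharp_def by blast

lemma sharp_eqI:
  assumes "r \<in> Sym2 scale" "\<xi> \<in> dual scale" "\<And>\<eta>. \<eta> \<in> dual scale \<Longrightarrow> \<eta> x = r \<xi> \<eta>"
  shows "sharp scale r \<xi> = x"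
  unfolding sharp_def
  by (rule the1_equality[OF sharp_exists_unique[OF assms(1,2)]]) (use assms(3) in blast)

lemma Sym2_commute:
  "r \<in> Sym2 scale \<Longrightarrow> \<xi> \<in> dual scale \<Longrightarrow> \<eta> \<in> dual scale \<Longrightarrow> r \<xi> \<eta> = r \<eta> \<xi>"
  unfolding Sym2_def by blast

lemma sharp_linear:
  assumes r: "r \<in> Sym2 scale"
  shows "linear_on_dual scale scale (sharp scale r)"
proof -
  have lin: "linear_on_dual scale (*) (\<lambda>\<xi>. r \<xi> \<eta>)" if "\<eta> \<in> dual scale" for \<eta>
    using r that unfolding Sym2_def by blast
  show ?thesis
    unfolding linear_on_dual_def
    by (intro conjI ballI allI)
      (rule sharp_eqI[OF r]; use lin in \<open>simp add: dual_add dual_scale dual_apply_add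
        dual_apply_scale sharp_pairing[OF r] linear_on_dual_def\<close>)+
qed

context
  fixes r :: "('b \<Rightarrow> 'a) \<Rightarrow> ('b \<Rightarrow> 'a) \<Rightarrow> 'a"
  assumes inv: "tensor_invertible scale r"
begin

lemma sharp_inv_in_dual: "sharp_inv scale r x \<in> dual scale"
  using inv unfolding tensor_invertible_def sharp_inv_def bij_betw_def
  by (metis UNIV_I inv_into_into)

lemma sharp_sharp_inv: "sharp scale r (sharp_inv scale r x) = x"
  using inv unfolding tensor_invertible_def sharp_inv_def
  by (metis UNIV_I bij_betw_inv_into_right)

lemma sharp_inv_sharp: "\<xi> \<in> dual scale \<Longrightarrow> sharp_inv scale r (sharp scale r \<xi>) = \<xi>"
  using inv unfolding tensor_invertible_def sharp_inv_def
  by (metis bij_betw_inv_into_left)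

lemma sharp_inv_add:
  "sharp_inv scale r (x + y) = (\<lambda>z. sharp_inv scale r x z + sharp_inv scale r y z)"
proof -
  have "sharp scale r (\<lambda>z. sharp_inv scale r x z + sharp_inv scale r y z) = x + y"
    using inv sharp_inv_in_dual
    unfolding tensor_invertible_def linear_on_dual_def by (simp add: sharp_sharp_inv)
  then show ?thesis
    by (metis dual_add sharp_inv_in_dual sharp_inv_sharp)
qed

lemma sharp_inv_scale:
  "sharp_inv scale r (scale c x) = (\<lambda>z. c * sharp_inv scale r x z)"
proof -
  have "sharp scale r (\<lambda>z. c * sharp_inv scale r x z) = scale c x"
    using inv sharp_inv_in_dual
    unfolding tensor_invertible_def linear_on_dual_def by (simp add: sharp_sharp_inv)
  then show ?thesis
    by (metis dual_scale sharp_inv_in_dual sharp_inv_sharp)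
qed

lemma sharp_inv_symmetric:
  assumes "r \<in> Sym2 scale"
  shows "sharp_inv scale r x y = sharp_inv scale r y x"
  using Sym2_commute[OF assms sharp_inv_in_dual[of x] sharp_inv_in_dual[of y]]
    sharp_pairing[OF assms sharp_inv_in_dual[of x] sharp_inv_in_dual[of y]]
    sharp_pairing[OF assms sharp_inv_in_dual[of y] sharp_inv_in_dual[of x]]
  by (simp add: sharp_sharp_inv)

lemma sharp_inv_nondegenerate:
  assumes "\<And>y. sharp_inv scale r y x = 0" and r: "r \<in> Sym2 scale"
  shows "x = 0"
proof -
  have "sharp_inv scale r x = sharp_inv scale r 0"
    using assms sharp_inv_symmetric[OF r] sharp_inv_scale[of 0 x] by fastforce
  then show ?thesis
    by (metis sharp_sharp_inv)
qed

text \<open>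
  The bracket of \<open>r\<close> with itself, evaluated at the preimages of \<open>x\<close>, \<open>y\<close>, \<open>z\<close> under the sharp map,
  is the closedness defect of the inverse form at \<open>x\<close>, \<open>y\<close>, \<open>z\<close>.
\<close>

lemma inverse_form_pseudo_hessian:
  assumes two: "(2::'a) \<noteq> 0" and s: "s_matrix scale mul r"
  shows "pseudo_hessian_structure scale mul (\<lambda>x y. sharp_inv scale r y x)"
proof -
  have r: "r \<in> Sym2 scale" and van: "s_bracket_vanishes scale mul r r"
    using s unfolding s_matrix_def by auto
  note sym = sharp_inv_symmetric[OF r]
  have "symmetric_bilinear_form scale (\<lambda>x y. sharp_inv scale r y x)"
    unfolding symmetric_bilinear_form_def
    using sharp_inv_in_dual sym by (simp add: dual_def)
  moreover have "sharp_inv scale r z (mul x y) - sharp_inv scale r (mul y z) x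
      = sharp_inv scale r z (mul y x) - sharp_inv scale r (mul x z) y" for x y z
  proof -
    have "s_bracket scale mul r r (sharp_inv scale r x) (sharp_inv scale r y)
        (sharp_inv scale r z) = 0"
      using van sharp_inv_in_dual unfolding s_bracket_vanishes_def by blast
    then have "2 * (sharp_inv scale r z (mul x y) - sharp_inv scale r (mul y z) x
      - (sharp_inv scale r z (mul y x) - sharp_inv scale r (mul x z) y)) = 0"
      using two unfolding s_bracket_def Let_def commutator_def
      by (simp add: sharp_sharp_inv dual_apply_add[OF sharp_inv_in_dual]
          dual_apply_diff[OF sharp_inv_in_dual] sym[of "mul _ _"] algebra_simps)
    then show ?thesis
      using two by (metis eq_iff_diff_eq_0 mult_eq_0_iff)
  qed
  ultimately show ?thesis
    unfolding pseudo_hessian_structure_def closed_form_def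
    using sharp_inv_nondegenerate[OF _ r] by blast
qed

end

section \<open>The operator relating two compatible tensors\<close>

lemma sharp_comp_sharp_inv_linear:
  assumes r1: "r1 \<in> Sym2 scale" and r2: "tensor_invertible scale r2"
  shows "Vector_Spaces.linear scale scale (sharp scale r1 \<circ> sharp_inv scale r2)"
  unfolding Vector_Spaces.linear_def module_hom_def module_hom_axioms_def
    module_iff_vector_space
  using sharp_linear[OF r1] sharp_inv_in_dual[OF r2] vector_space_axioms
  by (simp add: linear_on_dual_def sharp_inv_add[OF r2] sharp_inv_scale[OF r2])

text \<open>
  Let \<open>B\<close> be the inverse form of \<open>r2\<close> and call \<open>B(x, N y)\<close> the twisted form. At the preimages of
  \<open>x\<close>, \<open>y\<close>, \<open>z\<close>, twice the bracket of the two tensors is the sum of the defects of closedness of \<open>B\<close> at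
  \<open>(N x, y, z)\<close>, \<open>(x, N y, z)\<close> and \<open>(x, y, N z)\<close>, minus the defect of the twisted form at
  \<open>(x, y, z)\<close>. As \<open>B\<close> is closed, only the last one remains.
\<close>

lemma twisted_inverse_form_closed:
  fixes r1 r2 :: "('b \<Rightarrow> 'a) \<Rightarrow> ('b \<Rightarrow> 'a) \<Rightarrow> 'a"
  defines "N \<equiv> sharp scale r1 \<circ> sharp_inv scale r2"
  assumes two: "(2::'a) \<noteq> 0" and comp: "compatible_s_matrices scale mul r1 r2"
    and inv: "tensor_invertible scale r2"
  shows "closed_form scale mul (\<lambda>x y. sharp_inv scale r2 (N y) x)"
proof -
  have r1: "r1 \<in> Sym2 scale" and r2: "r2 \<in> Sym2 scale" and s2: "s_matrix scale mul r2"
    and van: "s_bracket_vanishes scale mul r1 r2"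
    using comp unfolding compatible_s_matrices_def s_matrix_def by auto
  let ?b = "sharp_inv scale r2"
  note sym = sharp_inv_symmetric[OF inv r2] and dual = sharp_inv_in_dual[OF inv]
  have N: "sharp scale r1 (?b x) = N x" for x
    by (simp add: N_def)
  have Nsym: "?b (N y) x = ?b (N x) y" for x y
    using sharp_pairing[OF r1 dual[of x] dual[of y]] sharp_pairing[OF r1 dual[of y] dual[of x]]
      Sym2_commute[OF r1 dual[of x] dual[of y]] sym[of "N y" x] sym[of "N x" y]
    by (simp add: N)
  have closed: "?b z (mul x y) - ?b (mul y z) x = ?b z (mul y x) - ?b (mul x z) y" for x y z
    using inverse_form_pseudo_hessian[OF inv two s2]
    unfolding pseudo_hessian_structure_def closed_form_def by blast
  have "?b (N z) (mul x y) - ?b (N (mul y z)) x = ?b (N z) (mul y x) - ?b (N (mul x z)) y"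
    for x y z
  proof -
    have "s_bracket scale mul r1 r2 (?b x) (?b y) (?b z) = 0"
      using van dual unfolding s_bracket_vanishes_def by blast
    then have "- (?b x (mul (N y) z) + ?b x (mul y (N z)))
        + (?b y (mul (N x) z) + ?b y (mul x (N z)))
        + (?b z (mul (N x) y) - ?b z (mul y (N x)) + (?b z (mul x (N y)) - ?b z (mul (N y) x))) = 0"
      using two unfolding s_bracket_def Let_def commutator_def
      by (simp add: N sharp_sharp_inv[OF inv] dual_apply_add[OF dual] dual_apply_diff[OF dual])
    then show ?thesis
      using closed[of z "N x" y] closed[of z x "N y"] closed[of "N z" x y]
      unfolding sym[of "mul _ _"] Nsym[of "mul _ _"] by algebra
  qed
  moreover have "symmetric_bilinear_form scale (\<lambda>x y. ?b (N y) x)"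
    unfolding symmetric_bilinear_form_def
    using dual Nsym by (simp add: dual_def)
  ultimately show ?thesis
    unfolding closed_form_def by blast
qed

lemma sharp_comp_sharp_inv_nijenhuis:
  fixes r1 r2 :: "('b \<Rightarrow> 'a) \<Rightarrow> ('b \<Rightarrow> 'a) \<Rightarrow> 'a"
  assumes two: "(2::'a) \<noteq> 0" and comp: "compatible_s_matrices scale mul r1 r2"
    and inv: "tensor_invertible scale r2"
  shows "nijenhuis_operator scale mul (sharp scale r1 \<circ> sharp_inv scale r2)"
proof (rule nijenhuis_if_closed_forms)
  have r1: "r1 \<in> Sym2 scale" and r2: "r2 \<in> Sym2 scale" and s2: "s_matrix scale mul r2"
    and van: "s_bracket_vanishes scale mul r1 r1"
    using comp unfolding compatible_s_matrices_def s_matrix_def by auto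
  let ?b = "sharp_inv scale r2" and ?N = "sharp scale r1 \<circ> sharp_inv scale r2"
  note dual = sharp_inv_in_dual[OF inv]
  show "pseudo_hessian_structure scale mul (\<lambda>x y. ?b y x)"
    by (rule inverse_form_pseudo_hessian[OF inv two s2])
  show "Vector_Spaces.linear scale scale ?N"
    by (rule sharp_comp_sharp_inv_linear[OF r1 inv])
  show "closed_form scale mul (\<lambda>x y. ?b (?N y) x)"
    by (rule twisted_inverse_form_closed[OF two comp inv])
  fix x y z
  have "s_bracket scale mul r1 r1 (?b x) (?b y) (?b z) = 0"
    using van dual unfolding s_bracket_vanishes_def by blast
  then have "2 * (?b x (mul (?N y) (?N z)) - ?b y (mul (?N x) (?N z))
      - ?b z (commutator mul (?N x) (?N y))) = 0"
    using two unfolding s_bracket_def Let_def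
    by (simp add: dual_apply_add[OF dual] algebra_simps)
  then have "?b x (mul (?N y) (?N z)) - ?b y (mul (?N x) (?N z))
      = ?b z (commutator mul (?N x) (?N y))"
    using two by (metis eq_iff_diff_eq_0 mult_eq_0_iff)
  then show "?b (mul (?N y) (?N z)) x - ?b (mul (?N x) (?N z)) y
      = ?b (commutator mul (?N x) (?N y)) z"
    by (simp add: sharp_inv_symmetric[OF inv r2, of _ x]
        sharp_inv_symmetric[OF inv r2, of _ y] sharp_inv_symmetric[OF inv r2, of _ z])
qed

end

theorem proposition6p7:
  fixes scale :: "'k::{alg_closed_field, field_char_0} \<Rightarrow> 'g::ab_group_add \<Rightarrow> 'g"
    and Basis :: "'g set"
    and mul :: "'g \<Rightarrow> 'g \<Rightarrow> 'g"
    and r1 r2 :: "('g \<Rightarrow> 'k) \<Rightarrow> ('g \<Rightarrow> 'k) \<Rightarrow> 'k"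
  assumes "finite_dimensional_vector_space scale Basis"
    and "pre_lie_algebra scale mul"
    and "compatible_s_matrices scale mul r1 r2"
    and "tensor_invertible scale r2"
  shows "nijenhuis_operator scale mul (sharp scale r1 \<circ> sharp_inv scale r2) \<and>
    (tensor_invertible scale r1 \<longrightarrow>
      pseudo_hessian_nijenhuis scale mul
        (\<lambda>x y. sharp_inv scale r1 y x) (sharp scale r1 \<circ> sharp_inv scale r2))"
proof -
  interpret finite_dimensional_vector_space scale Basis by (rule assms(1))
  have two: "(2::'k) \<noteq> 0" by simp
  note inv2 = assms(4)
  have s1: "s_matrix scale mul r1" and s2: "s_matrix scale mul r2" and r1: "r1 \<in> Sym2 scale"
    and r2: "r2 \<in> Sym2 scale"
    using assms(3) unfolding compatible_s_matrices_def s_matrix_def by auto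
  let ?b1 = "sharp_inv scale r1" and ?b2 = "sharp_inv scale r2"
  let ?N = "sharp scale r1 \<circ> ?b2"
  have nij: "nijenhuis_operator scale mul ?N"
    by (rule sharp_comp_sharp_inv_nijenhuis[OF two assms(3) inv2])
  moreover have "pseudo_hessian_nijenhuis scale mul (\<lambda>x y. ?b1 y x) ?N"
    if inv1: "tensor_invertible scale r1"
  proof -
    have b1N: "?b1 (?N y) = ?b2 y" for y
      by (simp add: sharp_inv_sharp[OF inv1] sharp_inv_in_dual[OF inv2])
    have "?b1 y (?N x) = ?b1 (?N y) x" for x y
      using sharp_inv_symmetric[OF inv1 r1, of y "?N x"] sharp_inv_symmetric[OF inv2 r2, of x y]
      by (simp only: b1N)
    moreover have "bij ?N"
    proof (rule bij_betw_trans)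
      show "bij_betw ?b2 UNIV (dual scale)"
        using inv2 unfolding tensor_invertible_def sharp_inv_def
        by (auto intro: bij_betw_inv_into)
      show "bij_betw (sharp scale r1) (dual scale) UNIV"
        using inv1 unfolding tensor_invertible_def by blast
    qed
    moreover have "closed_form scale mul (\<lambda>x y. ?b1 (?N y) x)"
      using inverse_form_pseudo_hessian[OF inv2 two s2]
      unfolding pseudo_hessian_structure_def b1N by blast
    ultimately show ?thesis
      unfolding pseudo_hessian_nijenhuis_def
      using assms(2) nij inverse_form_pseudo_hessian[OF inv1 two s1] by blast
  qed
  ultimately show ?thesis by blast
qed

end
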